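(* UM vectors are in bijection with tableaux with hook length bounded above by $n$ and with abelian ideals in the nilradical of the Lie algebra $\mathfrak{sl}_n$.
   Context: For $\pi\in\mathfrak{S}_n$ with permutation matrix $(\pi_{a,b})$, the Waldspurger matrix $\mathbf{WT}(\pi)$ is the $(n-1)\times(n-1)$ matrix with $$\mathbf{WT}(\pi)_{i,j}=\begin{cases}\sum_{a\le i,\ b>j}\pi_{a,b} & i\le j,\\ \sum_{a>i,\ b\le j}\pi_{a,b} & i\ge j\end{cases}$$ (the formulas agree for $i=j$). A UM vector is any vector that appears as a column of $\mathbf{WT}(\pi)$ for some permutation $\pi$; for $\pi\in\mathfrak{S}_n$ it has length $n-1$. "Tableaux" means Young diagrams (including the empty one). The hook length of a cell of a Young diagram is the number of cells to its right in its row plus the number of cells below it in its column plus one. $\mathfrak{sl}_n=\mathfrak{sl}_n(\mathbb{C})$ is the Lie algebra of traceless $n\times n$ complex matrices; let $\mathfrak{b}$ be its Borel subalgebra of upper triangular matrices and $\mathfrak{n}\subset\mathfrak{b}$ the nilradical, consisting of the strictly upper triangular matrices. Abelian ideals in the nilradical are ideals $I$ of $\mathfrak{b}$ with $I\subseteq\mathfrak{n}$ and $[I,I]=0$.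
   Formalization: "Hook length bounded above by n" is taken strictly (all hook lengths less than n), since with hook lengths at most n the claim is false (n = 2: 2 UM vectors but 4 tableaux); n is at least 2, since for n = 1 there are no UM vectors. *)

theory Defs
  imports
    Complex_Main
    "HOL-Combinatorics.Permutations"
    "Jordan_Normal_Form.Matrix"
begin

text \<open>
  All indices are zero-based: a permutation acts on \<open>{..<n}\<close>, and the entry \<open>(i, j)\<close> of a matrix
  is the entry in row \<open>i + 1\<close>, column \<open>j + 1\<close> in the usual one-based numbering. The comparisons
  of row and column indices in the definition of the Waldspurger matrix are unaffected by this
  shift.
\<close>

definition perm_matrix :: "nat \<Rightarrow> (nat \<Rightarrow> nat) \<Rightarrow> nat mat" where
  "perm_matrix n \<pi> = mat n n (\<lambda>(a, b). if \<pi> a = b then 1 else 0)"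

definition waldspurger :: "nat \<Rightarrow> (nat \<Rightarrow> nat) \<Rightarrow> nat mat" where
  "waldspurger n \<pi> = mat (n - 1) (n - 1) (\<lambda>(i, j).
     if i \<le> j
     then (\<Sum>a\<in>{a. a < n \<and> a \<le> i}. \<Sum>b\<in>{b. b < n \<and> b > j}. perm_matrix n \<pi> $$ (a, b))
     else (\<Sum>a\<in>{a. a < n \<and> a > i}. \<Sum>b\<in>{b. b < n \<and> b \<le> j}. perm_matrix n \<pi> $$ (a, b)))"

definition um_vectors :: "nat \<Rightarrow> nat vec set" where
  "um_vectors n = {col (waldspurger n \<pi>) j | \<pi> j. \<pi> permutes {..<n} \<and> j < n - 1}"

text \<open>
  A Young diagram is represented by its set of cells \<open>(row, column)\<close>, in the convention where row
  lengths weakly decrease downwards.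
\<close>

definition young_diagram :: "(nat \<times> nat) set \<Rightarrow> bool" where
  "young_diagram D \<longleftrightarrow> finite D \<and>
     (\<forall>i j i' j'. (i, j) \<in> D \<longrightarrow> i' \<le> i \<longrightarrow> j' \<le> j \<longrightarrow> (i', j') \<in> D)"

definition hook_length :: "(nat \<times> nat) set \<Rightarrow> nat \<times> nat \<Rightarrow> nat" where
  "hook_length D = (\<lambda>(i, j).
     card {j'. j' > j \<and> (i, j') \<in> D} + card {i'. i' > i \<and> (i', j) \<in> D} + 1)"

text \<open>
  The bound on the hook lengths is strict: there are \<open>2 ^ n\<close> Young diagrams with all hook lengths
  at most \<open>n\<close>, but only \<open>2 ^ (n - 1)\<close> UM vectors of length \<open>n - 1\<close> (and as many abelian ideals).
\<close>

definition hook_bounded_tableaux :: "nat \<Rightarrow> (nat \<times> nat) set set" where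
  "hook_bounded_tableaux n = {D. young_diagram D \<and> (\<forall>c\<in>D. hook_length D c < n)}"

definition mat_trace :: "complex mat \<Rightarrow> complex" where
  "mat_trace A = (\<Sum>i<dim_row A. A $$ (i, i))"

definition sl :: "nat \<Rightarrow> complex mat set" where
  "sl n = {A \<in> carrier_mat n n. mat_trace A = 0}"

definition lie_bracket :: "complex mat \<Rightarrow> complex mat \<Rightarrow> complex mat" where
  "lie_bracket A B = A * B - B * A"

definition borel_sl :: "nat \<Rightarrow> complex mat set" where
  "borel_sl n = {A \<in> sl n. upper_triangular A}"

definition nilradical_sl :: "nat \<Rightarrow> complex mat set" where
  "nilradical_sl n = {A \<in> borel_sl n. \<forall>i<n. A $$ (i, i) = 0}"

definition complex_subspace :: "nat \<Rightarrow> complex mat set \<Rightarrow> bool" where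
  "complex_subspace n V \<longleftrightarrow> V \<subseteq> carrier_mat n n \<and> 0\<^sub>m n n \<in> V \<and>
     (\<forall>A\<in>V. \<forall>B\<in>V. A + B \<in> V) \<and> (\<forall>c. \<forall>A\<in>V. c \<cdot>\<^sub>m A \<in> V)"

definition borel_ideal :: "nat \<Rightarrow> complex mat set \<Rightarrow> bool" where
  "borel_ideal n I \<longleftrightarrow> complex_subspace n I \<and> I \<subseteq> borel_sl n \<and>
     (\<forall>X\<in>borel_sl n. \<forall>A\<in>I. lie_bracket X A \<in> I)"

definition abelian_nilradical_ideals :: "nat \<Rightarrow> complex mat set set" where
  "abelian_nilradical_ideals n = {I. borel_ideal n I \<and> I \<subseteq> nilradical_sl n \<and>
     (\<forall>A\<in>I. \<forall>B\<in>I. lie_bracket A B = 0\<^sub>m n n)}"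

end

theory Submission
  imports Defs
begin

text \<open>
  All three families are in bijection with the subsets of \<open>{1..<n}\<close>.

  \<^item> Let \<open>T\<close> be the set of those \<open>a\<close> that a permutation moves from one side of the cut between
    \<open>{..j}\<close> and its complement to the other. As many points move up as down, so exactly half of \<open>T\<close>
    lies below the cut, and column \<open>j\<close> of the Waldspurger matrix is the tent-shaped vector
    with entries \<open>min (card (T \<inter> {..i})) (card (T \<inter> {i<..}))\<close>, in which \<open>j\<close> and the permutation
    occur only through \<open>T\<close>. Every \<open>T\<close> of even size arises in this way: cut \<open>T\<close> into two
    equal halves and exchange them. Since the size of \<open>T\<close> is even, both arguments of the minimum
    have the same parity, so the parities of the entries recover \<open>T\<close>. Thus UM vectors
    correspond to the even subsets of \<open>{..<n}\<close> (\<open>um_vectors_eq_tent_vecs\<close>, \<open>inj_on_tent_vec\<close>),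
    and forgetting whether \<open>0\<close> belongs to such a set leaves an arbitrary subset of \<open>{1..<n}\<close>.

  \<^item> The largest hook of a Young diagram is the one of its corner, and the diagram is
    determined by the hook lengths in its first column, which can be any finite set of positive
    integers (\<open>bij_betw_first_column_hooks\<close>).

  \<^item> An ideal of the Borel subalgebra inside the nilradical is stable under the torus, hence
    spanned by matrix units \<open>E\<^sub>i\<^sub>j\<close>; stability under the other \<open>E\<^sub>k\<^sub>l\<close> says that the positions \<open>(i, j)\<close>
    that occur are closed under moving up and to the right. Reading the columns from the right
    turns this set of positions into a Young diagram. The ideal is abelian iff no index is both a
    row and a column of an occurring position, that is, iff the numbers of rows and columns of the
    diagram add up to at most \<open>n\<close>, which is the bound on the corner hook (\<open>bij_betw_diagram_ideal\<close>).
\<close>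

section \<open>UM vectors and even subsets\<close>

definition crossings :: "nat \<Rightarrow> (nat \<Rightarrow> nat) \<Rightarrow> nat \<Rightarrow> nat set" where
  "crossings n \<pi> j = {a. a < n \<and> (a \<le> j) \<noteq> (\<pi> a \<le> j)}"

definition tent_vec :: "nat \<Rightarrow> nat set \<Rightarrow> nat vec" where
  "tent_vec n T = vec (n - 1) (\<lambda>i. min (card (T \<inter> {..i})) (card (T \<inter> {i<..})))"

definition even_subsets :: "nat \<Rightarrow> nat set set" where
  "even_subsets n = {T. T \<subseteq> {..<n} \<and> even (card T)}"

text \<open>
  Block sums of a permutation matrix are cardinalities; this turns the entries of the Waldspurger
  matrix into counts of points.
\<close>

lemma sum_indicator_block:
  fixes A B :: "nat set" and \<pi> :: "nat \<Rightarrow> nat"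
  assumes "finite A" "finite B"
  shows "(\<Sum>a\<in>A. \<Sum>b\<in>B. if \<pi> a = b then 1 else 0 :: nat) = card {a \<in> A. \<pi> a \<in> B}"
proof -
  have "(\<Sum>a\<in>A. \<Sum>b\<in>B. if \<pi> a = b then 1 else 0 :: nat) = (\<Sum>a\<in>A. if \<pi> a \<in> B then 1 else 0)"
    using assms by (intro sum.cong refl) simp
  also have "\<dots> = card {a \<in> A. \<pi> a \<in> B}"
    using assms(1) by (simp flip: sum.inter_filter)
  finally show ?thesis .
qed

lemma card_split_at:
  fixes T :: "nat set"
  assumes "finite T"
  shows "card T = card (T \<inter> {..i}) + card (T \<inter> {i<..})"
proof -
  have "T = (T \<inter> {..i}) \<union> (T \<inter> {i<..})" by auto
  then show ?thesis
    using assms by (metis card_Un_disjoint finite_Int disjoint_iff IntD2 atMost_iff greaterThan_iff not_le)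
qed

text \<open>
  A point \<open>a \<le> i\<close> with \<open>i \<le> j\<close> starts below the cut at \<open>j\<close>, so its image exceeds \<open>j\<close> exactly when
  \<open>a\<close> crosses the cut; dually for the points above \<open>i\<close> when \<open>i > j\<close>.
\<close>

lemma waldspurger_entry:
  assumes \<pi>: "\<pi> permutes {..<n}" and i: "i < n - 1" and j: "j < n - 1"
  shows "waldspurger n \<pi> $$ (i, j) =
    (if i \<le> j then card (crossings n \<pi> j \<inter> {..i}) else card (crossings n \<pi> j \<inter> {i<..}))"
proof -
  have in_range: "\<pi> a < n" if "a < n" for a
    using permutes_in_image[OF \<pi>, of a] that by simp
  have "(\<Sum>a\<in>{a. a < n \<and> a \<le> i}. \<Sum>b\<in>{b. b < n \<and> b > j}. perm_matrix n \<pi> $$ (a, b))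
     = (\<Sum>a\<in>{a. a < n \<and> a \<le> i}. \<Sum>b\<in>{b. b < n \<and> b > j}. if \<pi> a = b then 1 else 0)"
    by (intro sum.cong refl) (simp add: perm_matrix_def)
  also have "\<dots> = card {a \<in> {a. a < n \<and> a \<le> i}. \<pi> a \<in> {b. b < n \<and> b > j}}"
    by (rule sum_indicator_block) auto
  finally have upper: "(\<Sum>a\<in>{a. a < n \<and> a \<le> i}. \<Sum>b\<in>{b. b < n \<and> b > j}. perm_matrix n \<pi> $$ (a, b))
     = card {a \<in> {a. a < n \<and> a \<le> i}. \<pi> a \<in> {b. b < n \<and> b > j}}" .
  have upper_set: "{a \<in> {a. a < n \<and> a \<le> i}. \<pi> a \<in> {b. b < n \<and> b > j}} = crossings n \<pi> j \<inter> {..i}" if "i \<le> j"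
  proof (rule Set.set_eqI)
    show "a \<in> {a \<in> {a. a < n \<and> a \<le> i}. \<pi> a \<in> {b. b < n \<and> b > j}} \<longleftrightarrow> a \<in> crossings n \<pi> j \<inter> {..i}" for a
      using that in_range[of a] unfolding crossings_def by auto
  qed
  have "(\<Sum>a\<in>{a. a < n \<and> a > i}. \<Sum>b\<in>{b. b < n \<and> b \<le> j}. perm_matrix n \<pi> $$ (a, b))
     = (\<Sum>a\<in>{a. a < n \<and> a > i}. \<Sum>b\<in>{b. b < n \<and> b \<le> j}. if \<pi> a = b then 1 else 0)"
    by (intro sum.cong refl) (simp add: perm_matrix_def)
  also have "\<dots> = card {a \<in> {a. a < n \<and> a > i}. \<pi> a \<in> {b. b < n \<and> b \<le> j}}"
    by (rule sum_indicator_block) auto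
  finally have lower: "(\<Sum>a\<in>{a. a < n \<and> a > i}. \<Sum>b\<in>{b. b < n \<and> b \<le> j}. perm_matrix n \<pi> $$ (a, b))
     = card {a \<in> {a. a < n \<and> a > i}. \<pi> a \<in> {b. b < n \<and> b \<le> j}}" .
  have lower_set: "{a \<in> {a. a < n \<and> a > i}. \<pi> a \<in> {b. b < n \<and> b \<le> j}} = crossings n \<pi> j \<inter> {i<..}" if "\<not> i \<le> j"
  proof (rule Set.set_eqI)
    show "a \<in> {a \<in> {a. a < n \<and> a > i}. \<pi> a \<in> {b. b < n \<and> b \<le> j}} \<longleftrightarrow> a \<in> crossings n \<pi> j \<inter> {i<..}" for a
      using that in_range[of a] unfolding crossings_def by auto
  qed
  show ?thesis
    using i j by (simp add: waldspurger_def upper lower upper_set lower_set del: mem_Collect_eq)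
qed

text \<open>
  Exactly \<open>j + 1\<close> points are mapped to \<open>{..j}\<close>, as many as start there, so the points leaving
  \<open>{..j}\<close> and the points entering it are equally numerous.
\<close>

lemma crossings_balanced:
  assumes \<pi>: "\<pi> permutes {..<n}" and j: "j < n"
  shows "card (crossings n \<pi> j \<inter> {..j}) = card (crossings n \<pi> j \<inter> {j<..})"
proof -
  let ?T = "crossings n \<pi> j"
  have fin: "finite ?T" by (simp add: crossings_def)
  \<comment> \<open>The points mapped to \<open>{..j}\<close> are those that stay below the cut and those that enter from above.\<close>
  have "bij_betw \<pi> {a. a < n \<and> \<pi> a \<le> j} {..j}"
  proof (rule bij_betwI')
    show "(\<pi> x = \<pi> y) = (x = y)" for x y
      using permutes_inj[OF \<pi>] by (simp add: inj_eq)
    show "\<exists>x\<in>{a. a < n \<and> \<pi> a \<le> j}. y = \<pi> x" if "y \<in> {..j}" for y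
    proof -
      have "y \<in> \<pi> ` {..<n}" using permutes_image[OF \<pi>] that j by simp
      then show ?thesis using that by auto
    qed
  qed auto
  then have "card {a. a < n \<and> \<pi> a \<le> j} = card {..j}" by (rule bij_betw_same_card)
  also have "{a. a < n \<and> \<pi> a \<le> j} = ({..j} - (?T \<inter> {..j})) \<union> (?T \<inter> {j<..})"
    using j by (auto simp: crossings_def)
  also have "card \<dots> = card ({..j} - (?T \<inter> {..j})) + card (?T \<inter> {j<..})"
    using fin by (intro card_Un_disjoint) auto
  also have "card ({..j} - (?T \<inter> {..j})) = card {..j} - card (?T \<inter> {..j})"
    by (intro card_Diff_subset) (use fin in auto)
  finally show ?thesis
    using card_mono[of "{..j}" "?T \<inter> {..j}"] by simp
qed

text \<open>
  The two cases of an entry merge into a minimum: to the left of \<open>j\<close> the first count is at most half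
  of the crossings and the second at least half, and to the right of \<open>j\<close> it is the other way
  round.
\<close>

lemma waldspurger_col:
  assumes \<pi>: "\<pi> permutes {..<n}" and j: "j < n - 1"
  shows "col (waldspurger n \<pi>) j = tent_vec n (crossings n \<pi> j)"
proof (rule eq_vecI)
  let ?T = "crossings n \<pi> j"
  have fin: "finite ?T" by (simp add: crossings_def)
  have bal: "card (?T \<inter> {..j}) = card (?T \<inter> {j<..})"
    by (rule crossings_balanced[OF \<pi>]) (use j in simp)
  show "dim_vec (col (waldspurger n \<pi>) j) = dim_vec (tent_vec n ?T)"
    by (simp add: waldspurger_def tent_vec_def)
  fix i assume "i < dim_vec (tent_vec n ?T)"
  then have i: "i < n - 1" by (simp add: tent_vec_def)
  have "col (waldspurger n \<pi>) j $ i = waldspurger n \<pi> $$ (i, j)"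
    using i j by (simp add: waldspurger_def)
  also have "\<dots> = min (card (?T \<inter> {..i})) (card (?T \<inter> {i<..}))"
  proof (cases "i \<le> j")
    case True
    have "card (?T \<inter> {..i}) \<le> card (?T \<inter> {..j})" "card (?T \<inter> {j<..}) \<le> card (?T \<inter> {i<..})"
      using True fin by (intro card_mono; auto)+
    then show ?thesis using True bal waldspurger_entry[OF \<pi> i j] by simp
  next
    case False
    have "card (?T \<inter> {..j}) \<le> card (?T \<inter> {..i})" "card (?T \<inter> {i<..}) \<le> card (?T \<inter> {j<..})"
      using False fin by (intro card_mono; auto)+
    then show ?thesis using False bal waldspurger_entry[OF \<pi> i j] by simp
  qed
  finally show "col (waldspurger n \<pi>) j $ i = tent_vec n ?T $ i"
    using i by (simp add: tent_vec_def)
qed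

text \<open>
  As \<open>j\<close> grows by one, \<open>card (T \<inter> {..j})\<close> grows by at most one, so it attains the value
  \<open>card T div 2\<close>. The first \<open>j\<close> where this happens is smaller than \<open>n - 1\<close>, as an index of a column
  must be.
\<close>

lemma balancing_index:
  fixes n :: nat
  assumes "n \<ge> 2" and T: "T \<subseteq> {..<n}" "even (card T)"
  obtains j where "j < n - 1" "card (T \<inter> {..j}) = card (T \<inter> {j<..})"
proof -
  have fin: "finite T" by (rule finite_subset[OF T(1)]) simp
  obtain k where k: "card T = 2 * k" using T(2) by blast
  define j where "j = (LEAST j. k \<le> card (T \<inter> {..j}))"
  have all: "T \<inter> {..n - 1} = T" using T(1) \<open>n \<ge> 2\<close> by fastforce
  have ge: "k \<le> card (T \<inter> {..j})"
    unfolding j_def by (rule LeastI[of _ "n - 1"]) (simp only: all k)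
  have below: "card (T \<inter> {..i}) < k" if "i < j" for i
    using not_less_Least that unfolding j_def by fastforce
  have "card (T \<inter> {..j}) = k \<and> j < n - 1"
  proof (cases j)
    case 0
    have "card (T \<inter> {..0}) \<le> card {0::nat}" by (intro card_mono) auto
    show ?thesis
    proof (cases "k = 0")
      case True
      then show ?thesis using 0 k fin \<open>n \<ge> 2\<close> by simp
    next
      case False
      then show ?thesis using 0 ge \<open>n \<ge> 2\<close> \<open>card (T \<inter> {..0}) \<le> card {0::nat}\<close> by simp
    qed
  next
    case (Suc i)
    have "card (T \<inter> {..j}) \<le> card (insert j (T \<inter> {..i}))"
      using fin Suc by (intro card_mono) (auto simp: le_Suc_eq)
    also have "\<dots> \<le> Suc (card (T \<inter> {..i}))"
      using fin by (simp add: card_insert_if)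
    finally have eq: "card (T \<inter> {..j}) = k" using ge below[of i] Suc by simp
    have "\<not> n - 1 \<le> j"
    proof
      assume "n - 1 \<le> j"
      then have "T \<inter> {..j} = T" using T(1) by auto
      then show False using eq k below[of i] Suc by simp
    qed
    then show ?thesis using eq by simp
  qed
  then show ?thesis
    using that[of j] card_split_at[OF fin, of j] k by simp
qed

text \<open>
  It suffices to prescribe which points go to \<open>{..j}\<close>: the symmetric difference of \<open>{..j}\<close> and
  \<open>T\<close>. By balance it has as many elements as \<open>{..j}\<close>, so any bijections between the two parts and
  between their complements combine to a permutation.
\<close>

lemma exists_permutation_with_crossings:
  assumes "j < n" and T: "T \<subseteq> {..<n}"
    and bal: "card (T \<inter> {..j}) = card (T \<inter> {j<..})"
  obtains \<pi> where "\<pi> permutes {..<n}" "crossings n \<pi> j = T"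
proof -
  have fin: "finite T" by (rule finite_subset[OF T]) simp
  define A where "A = ({..j} - (T \<inter> {..j})) \<union> (T \<inter> {j<..})"
  have A: "A \<subseteq> {..<n}" using T \<open>j < n\<close> by (auto simp: A_def)
  have J: "{..j} \<subseteq> {..<n}" using \<open>j < n\<close> by auto
  have "card A = card ({..j} - (T \<inter> {..j})) + card (T \<inter> {j<..})"
    unfolding A_def using fin by (intro card_Un_disjoint) auto
  also have "card ({..j} - (T \<inter> {..j})) = card {..j} - card (T \<inter> {..j})"
    by (intro card_Diff_subset) (use fin in auto)
  finally have cA: "card A = card {..j}"
    using bal card_mono[of "{..j}" "T \<inter> {..j}"] by simp
  then have cB: "card ({..<n} - A) = card ({..<n} - {..j})"
    using A J by (simp add: card_Diff_subset finite_subset[OF A])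
  obtain f where f: "bij_betw f A {..j}"
    using finite_same_card_bij[OF finite_subset[OF A] _ cA] by auto
  obtain g where g: "bij_betw g ({..<n} - A) ({..<n} - {..j})"
    using finite_same_card_bij[OF _ _ cB] by auto
  define \<pi> where "\<pi> x = (if x \<in> A then f x else if x < n then g x else x)" for x
  have f': "bij_betw \<pi> A {..j}"
    using f by (rule bij_betw_cong[THEN iffD1, rotated]) (simp add: \<pi>_def)
  have g': "bij_betw \<pi> ({..<n} - A) ({..<n} - {..j})"
    using g by (rule bij_betw_cong[THEN iffD1, rotated]) (simp add: \<pi>_def)
  have "bij_betw \<pi> (A \<union> ({..<n} - A)) ({..j} \<union> ({..<n} - {..j}))"
    using f' g' by (rule bij_betw_combine) auto
  moreover have "A \<union> ({..<n} - A) = {..<n}" "{..j} \<union> ({..<n} - {..j}) = {..<n}"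
    using A J by auto
  ultimately have "bij_betw \<pi> {..<n} {..<n}" by simp
  then have perm: "\<pi> permutes {..<n}"
    by (rule bij_imp_permutes) (use A in \<open>auto simp: \<pi>_def\<close>)
  have le_iff: "\<pi> a \<le> j \<longleftrightarrow> a \<in> A" if "a < n" for a
    using bij_betwE[OF f'] bij_betwE[OF g'] that by fastforce
  have "crossings n \<pi> j = T"
    using le_iff T \<open>j < n\<close> by (auto simp: crossings_def A_def)
  then show ?thesis using that perm by blast
qed

lemma um_vectors_eq_tent_vecs:
  assumes "n \<ge> 2"
  shows "um_vectors n = tent_vec n ` even_subsets n"
proof (intro equalityI subsetI)
  fix v assume "v \<in> um_vectors n"
  then obtain \<pi> j where \<pi>: "\<pi> permutes {..<n}" and j: "j < n - 1"
    and v: "v = col (waldspurger n \<pi>) j"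
    by (auto simp: um_vectors_def)
  have "finite (crossings n \<pi> j)" "crossings n \<pi> j \<subseteq> {..<n}" by (auto simp: crossings_def)
  then have "crossings n \<pi> j \<in> even_subsets n"
    using card_split_at[of "crossings n \<pi> j" j] crossings_balanced[OF \<pi>, of j] j
    by (simp add: even_subsets_def)
  then show "v \<in> tent_vec n ` even_subsets n"
    using v waldspurger_col[OF \<pi> j] by blast
next
  fix v assume "v \<in> tent_vec n ` even_subsets n"
  then obtain T where T: "T \<subseteq> {..<n}" "even (card T)" and v: "v = tent_vec n T"
    by (auto simp: even_subsets_def)
  obtain j where j: "j < n - 1" "card (T \<inter> {..j}) = card (T \<inter> {j<..})"
    using balancing_index[OF assms T] by blast
  have "j < n" using j(1) by simp
  then obtain \<pi> where \<pi>: "\<pi> permutes {..<n}" "crossings n \<pi> j = T"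
    by (rule exists_permutation_with_crossings[OF _ T(1) j(2)])
  show "v \<in> um_vectors n"
  proof -
    have "v = col (waldspurger n \<pi>) j" using v \<pi>(2) waldspurger_col[OF \<pi>(1) j(1)] by simp
    then show ?thesis unfolding um_vectors_def using \<pi>(1) j(1) by blast
  qed
qed

lemma even_tent_entry:
  assumes "finite T" "even (card T)" "i < n - 1"
  shows "even (tent_vec n T $ i) \<longleftrightarrow> even (card (T \<inter> {..i}))"
  using assms card_split_at[of T i] by (simp add: tent_vec_def min_def)

lemma member_iff_prefix_parity:
  fixes T :: "nat set"
  shows "i \<in> T \<longleftrightarrow> even (card (T \<inter> {..i})) \<noteq> even (card (T \<inter> {..<i}))"
proof -
  have fin: "finite (T \<inter> {..<i})" by simp
  show ?thesis
  proof (cases "i \<in> T")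
    case True
    then have "T \<inter> {..i} = insert i (T \<inter> {..<i})" by auto
    then show ?thesis using True fin by simp
  next
    case False
    then have "T \<inter> {..i} = T \<inter> {..<i}" by (auto simp: le_less)
    then show ?thesis using False by simp
  qed
qed

text \<open>
  The parities of the entries are the parities of the initial segments \<open>T \<inter> {..i}\<close> for
  \<open>i < n - 1\<close>; the last segment is \<open>T\<close> itself, which is even. Consecutive parities differ exactly
  at the elements of \<open>T\<close>.
\<close>

lemma inj_on_tent_vec:
  "inj_on (tent_vec n) (even_subsets n)"
proof (rule inj_onI)
  fix S T assume S: "S \<in> even_subsets n" and T: "T \<in> even_subsets n"
    and eq: "tent_vec n S = tent_vec n T"
  have sub: "S \<subseteq> {..<n}" "T \<subseteq> {..<n}" and ev: "even (card S)" "even (card T)"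
    using S T by (auto simp: even_subsets_def)
  have fin: "finite S" "finite T"
    by (rule finite_subset[OF sub(1)], simp, rule finite_subset[OF sub(2)], simp)
  have prefix: "even (card (S \<inter> {..<i})) \<longleftrightarrow> even (card (T \<inter> {..<i}))" if "i \<le> n" for i
  proof (cases "i = n")
    case True
    have "S \<inter> {..<n} = S" "T \<inter> {..<n} = T" using sub by auto
    then show ?thesis using True ev by simp
  next
    case False
    show ?thesis
    proof (cases i)
      case (Suc i')
      then have "i' < n - 1" using that False by simp
      then show ?thesis
        using even_tent_entry[OF fin(1) ev(1), of i' n] even_tent_entry[OF fin(2) ev(2), of i' n] eq Suc
        by (simp add: lessThan_Suc_atMost)
    qed simp
  qed
  have "i \<in> S \<longleftrightarrow> i \<in> T" if "i < n" for i
    using prefix[of i] prefix[of "Suc i"] that member_iff_prefix_parity[of i S]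
      member_iff_prefix_parity[of i T] by (simp add: lessThan_Suc_atMost)
  then show "S = T" using sub by blast
qed

text \<open>
  Membership of \<open>0\<close> serves as a parity bit: it is determined by the other elements.
\<close>

lemma bij_betw_even_subsets_Pow:
  assumes "n \<ge> 1"
  shows "bij_betw (\<lambda>T. T - {0}) (even_subsets n) (Pow {1..<n})"
proof (rule bij_betw_byWitness[where f' = "\<lambda>B. if even (card B) then B else insert 0 B"])
  show "\<forall>T\<in>even_subsets n. (if even (card (T - {0})) then T - {0} else insert 0 (T - {0})) = T"
  proof
    fix T assume T: "T \<in> even_subsets n"
    then have "T \<subseteq> {..<n}" "even (card T)" by (auto simp: even_subsets_def)
    moreover from this have "finite T" by (metis finite_lessThan finite_subset)
    ultimately have "even (card (T - {0})) \<longleftrightarrow> 0 \<notin> T"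
      by (metis Diff_empty Diff_insert0 card.remove even_Suc)
    then show "(if even (card (T - {0})) then T - {0} else insert 0 (T - {0})) = T"
      by (simp add: insert_absorb)
  qed
  show "\<forall>B\<in>Pow {1..<n}. (if even (card B) then B else insert 0 B) - {0} = B"
    by auto
  show "(\<lambda>T. T - {0}) ` even_subsets n \<subseteq> Pow {1..<n}"
    by (auto simp: even_subsets_def Suc_le_eq)
  show "(\<lambda>B. if even (card B) then B else insert 0 B) ` Pow {1..<n} \<subseteq> even_subsets n"
  proof (rule image_subsetI)
    fix B assume "B \<in> Pow {1..<n}"
    then have B: "B \<subseteq> {1..<n}" "0 \<notin> B" by auto
    moreover have "finite B" by (rule finite_subset[OF B(1)]) simp
    ultimately show "(if even (card B) then B else insert 0 B) \<in> even_subsets n"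
      using assms by (auto simp: even_subsets_def)
  qed
qed

section \<open>Young diagrams and their first-column hooks\<close>

definition first_column_hooks :: "(nat \<times> nat) set \<Rightarrow> nat set" where
  "first_column_hooks D = {hook_length D (i, 0) | i. (i, 0) \<in> D}"

text \<open>
  Inverse of \<open>first_column_hooks\<close>. A cell in the first column has a hook consisting of the row of the
  cell and of one cell for each lower row, and hooks decrease downwards. So the row with hook
  \<open>b \<in> B\<close> comes after one row for each larger element of \<open>B\<close>, and its length is \<open>b\<close> minus the number
  of smaller elements.
\<close>

definition diagram_of_hooks :: "nat set \<Rightarrow> (nat \<times> nat) set" where
  "diagram_of_hooks B = {(i, j). \<exists>b\<in>B. i = card {b'\<in>B. b' > b} \<and> j + card {b'\<in>B. b' < b} < b}"

lemma finite_down_closed_eq_lessThan: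
  fixes S :: "nat set"
  assumes "finite S" "\<And>x y. x \<in> S \<Longrightarrow> y \<le> x \<Longrightarrow> y \<in> S"
  shows "S = {..<card S}"
proof (cases "S = {}")
  case False
  have "S = {..Max S}" using assms False by (auto intro: Max_ge assms(2)[OF Max_in])
  then have "S = {..<Suc (Max S)}" by (simp add: lessThan_Suc_atMost)
  then show ?thesis by (metis card_lessThan)
qed simp

lemma young_diagram_down:
  "young_diagram D \<Longrightarrow> (i, j) \<in> D \<Longrightarrow> i' \<le> i \<Longrightarrow> j' \<le> j \<Longrightarrow> (i', j') \<in> D"
  unfolding young_diagram_def by blast

lemma young_diagram_lines:
  assumes "young_diagram D"
  shows "(i, j) \<in> D \<longleftrightarrow> j < card {j. (i, j) \<in> D}"
    and "(i, j) \<in> D \<longleftrightarrow> i < card {i. (i, j) \<in> D}"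
proof -
  have fin: "finite D" using assms by (simp add: young_diagram_def)
  have "finite {j. (i, j) \<in> D}"
    by (rule finite_subset[OF _ finite_imageI[OF fin, of snd]]) force
  then have "{j. (i, j) \<in> D} = {..<card {j. (i, j) \<in> D}}"
    by (rule finite_down_closed_eq_lessThan) (auto intro: young_diagram_down[OF assms])
  then show "(i, j) \<in> D \<longleftrightarrow> j < card {j. (i, j) \<in> D}" by blast
  have "finite {i. (i, j) \<in> D}"
    by (rule finite_subset[OF _ finite_imageI[OF fin, of fst]]) force
  then have "{i. (i, j) \<in> D} = {..<card {i. (i, j) \<in> D}}"
    by (rule finite_down_closed_eq_lessThan) (auto intro: young_diagram_down[OF assms])
  then show "(i, j) \<in> D \<longleftrightarrow> i < card {i. (i, j) \<in> D}" by blast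
qed

lemma hook_length_eq:
  assumes D: "young_diagram D" and cell: "(i, j) \<in> D"
  shows "hook_length D (i, j) =
    card {j'. (i, j') \<in> D} + card {i'. (i', j) \<in> D} - (i + j + 1)"
    and "j < card {j'. (i, j') \<in> D}" and "i < card {i'. (i', j) \<in> D}"
proof -
  define r where "r = card {j'. (i, j') \<in> D}"
  define c where "c = card {i'. (i', j) \<in> D}"
  have row: "(i, j') \<in> D \<longleftrightarrow> j' < r" for j'
    unfolding r_def by (rule young_diagram_lines(1)[OF D])
  have col: "(i', j) \<in> D \<longleftrightarrow> i' < c" for i'
    unfolding c_def by (rule young_diagram_lines(2)[OF D])
  have lt: "j < r" "i < c" using row[of j] col[of i] cell by simp_all
  then show "j < card {j'. (i, j') \<in> D}" "i < card {i'. (i', j) \<in> D}"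
    by (simp_all only: r_def c_def)
  have "{j'. j' > j \<and> (i, j') \<in> D} = {j<..<r}" by (auto simp: row)
  moreover have "{i'. i' > i \<and> (i', j) \<in> D} = {i<..<c}" by (auto simp: col)
  ultimately have "hook_length D (i, j) = r + c - (i + j + 1)"
    using lt by (simp add: hook_length_def)
  then show "hook_length D (i, j) =
      card {j'. (i, j') \<in> D} + card {i'. (i', j) \<in> D} - (i + j + 1)"
    by (simp only: r_def c_def)
qed

text \<open>
  The hook of a cell is at most the hook of the corner \<open>(0, 0)\<close>, whose length is the number of rows
  plus the number of columns minus one. The condition on the right expresses the bound on
  this number without counting, by the last row and the last column.
\<close>

lemma hook_bounded_iff:
  assumes D: "young_diagram D"
  shows "(\<forall>c\<in>D. hook_length D c < n) \<longleftrightarrow> (\<forall>i j. (i, 0) \<in> D \<longrightarrow> (0, j) \<in> D \<longrightarrow> i + j + 1 < n)"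
proof (intro iffI allI impI ballI)
  fix i j assume *: "\<forall>c\<in>D. hook_length D c < n" and i: "(i, 0) \<in> D" and j: "(0, j) \<in> D"
  have corner: "(0, 0) \<in> D" by (rule young_diagram_down[OF D i]) auto
  then have "hook_length D (0, 0) < n" using * by blast
  then show "i + j + 1 < n"
    using hook_length_eq(1)[OF D corner] hook_length_eq(3)[OF D i] hook_length_eq(2)[OF D j]
    by linarith
next
  fix c assume *: "\<forall>i j. (i, 0) \<in> D \<longrightarrow> (0, j) \<in> D \<longrightarrow> i + j + 1 < n" and "c \<in> D"
  obtain i j where c: "c = (i, j)" by (cases c)
  define r where "r = card {j'. (i, j') \<in> D}"
  define k where "k = card {i'. (i', j) \<in> D}"
  have cell: "(i, j) \<in> D" using \<open>c \<in> D\<close> c by simp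
  have lt: "j < r" "i < k" using hook_length_eq(2,3)[OF D cell] by (simp_all add: r_def k_def)
  have "(i, r - 1) \<in> D" "(k - 1, j) \<in> D"
    using young_diagram_lines(1)[OF D, of i "r - 1"] young_diagram_lines(2)[OF D, of "k - 1" j] lt
    by (simp_all flip: r_def k_def)
  then have "(0, r - 1) \<in> D" "(k - 1, 0) \<in> D"
    using young_diagram_down[OF D] by blast+
  then have "k - 1 + (r - 1) + 1 < n" using * by blast
  then show "hook_length D c < n"
    using lt hook_length_eq(1)[OF D cell] c by (simp add: r_def k_def)
qed

lemma first_column_hooks_subset:
  assumes "D \<in> hook_bounded_tableaux n"
  shows "first_column_hooks D \<subseteq> {1..<n}"
  using assms by (auto simp: first_column_hooks_def hook_bounded_tableaux_def hook_length_def)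

text \<open>
  With \<open>R\<close> rows of lengths \<open>r i\<close>, the hook in row \<open>i\<close> of the first column is \<open>r i + R - (i + 1)\<close>. Row
  lengths decrease weakly, so these numbers decrease strictly, and the position of a
  hook among them is the index of its row.
\<close>

lemma diagram_of_first_column_hooks:
  assumes D: "young_diagram D"
  shows "diagram_of_hooks (first_column_hooks D) = D"
proof -
  define R where "R = card {i. (i, 0) \<in> D}"
  define r where "r i = card {j. (i, j) \<in> D}" for i
  define h where "h i = hook_length D (i, 0)" for i
  have row: "(i, j) \<in> D \<longleftrightarrow> j < r i" for i j
    unfolding r_def by (rule young_diagram_lines(1)[OF D])
  have col: "(i, 0) \<in> D \<longleftrightarrow> i < R" for i
    unfolding R_def by (rule young_diagram_lines(2)[OF D])
  have h: "h i = r i + R - (i + 1)" if "i < R" for i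
    using hook_length_eq(1)[OF D, of i 0] col[of i] that by (simp add: h_def r_def R_def)
  have anti: "r i' \<le> r i" if "i \<le> i'" for i i'
  proof (rule ccontr)
    assume "\<not> r i' \<le> r i"
    then have "(i', r i) \<in> D" using row by simp
    then have "(i, r i) \<in> D" by (rule young_diagram_down[OF D]) (use that in auto)
    then show False using row by simp
  qed
  have less_iff: "h i < h i' \<longleftrightarrow> i' < i" if "i < R" "i' < R" for i i'
  proof -
    have "h i < h i'" if "i' < i" "i < R" for i i'
      using h[of i] h[of i'] anti[of i' i] that by linarith
    then show ?thesis using that by (metis linorder_cases less_asym less_irrefl)
  qed
  have B: "first_column_hooks D = h ` {..<R}"
    by (auto simp: first_column_hooks_def h_def col)
  have inj: "inj_on h {..<R}"
    using less_iff by (intro inj_onI) (metis lessThan_iff linorder_cases less_irrefl)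
  have above: "card {b' \<in> h ` {..<R}. b' > h i} = i" if "i < R" for i
  proof -
    have "{b' \<in> h ` {..<R}. b' > h i} = h ` {..<i}" using that by (auto simp: less_iff)
    then show ?thesis using inj that by (simp add: card_image inj_on_subset)
  qed
  have below: "card {b' \<in> h ` {..<R}. b' < h i} = R - (i + 1)" if "i < R" for i
  proof -
    have "{b' \<in> h ` {..<R}. b' < h i} = h ` {i<..<R}" using that by (auto simp: less_iff)
    moreover have "inj_on h {i<..<R}" using inj by (rule inj_on_subset) auto
    ultimately show ?thesis by (simp add: card_image)
  qed
  have "(i, j) \<in> diagram_of_hooks (first_column_hooks D) \<longleftrightarrow> i < R \<and> j < r i" for i j
  proof -
    have "(i, j) \<in> diagram_of_hooks (first_column_hooks D) \<longleftrightarrow>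
        (\<exists>i'<R. i = i' \<and> j + (R - (i' + 1)) < h i')"
      unfolding diagram_of_hooks_def B by (auto simp: above below)
    also have "\<dots> \<longleftrightarrow> i < R \<and> j < r i" by (auto simp: h)
    finally show ?thesis .
  qed
  moreover have "i < R \<and> j < r i \<longleftrightarrow> (i, j) \<in> D" for i j
    using row[of i j] row[of i 0] col[of i] by auto
  ultimately show ?thesis by auto
qed

text \<open>
  Let \<open>r b\<close> and \<open>s b\<close> count the larger and the smaller elements of \<open>B\<close>, so that
  \<open>r b + s b + 1 = card B\<close>. Row \<open>r b\<close> has length \<open>b - s b\<close>, which is positive because the \<open>s b\<close>
  smaller elements lie in \<open>{1..<b}\<close>, and which grows with \<open>b\<close> because there are at most \<open>b' - b\<close>
  elements between \<open>b\<close> and \<open>b'\<close>. Hence the rows form a Young diagram, and the hook at \<open>(r b, 0)\<close> has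
  length \<open>(b - s b) + (card B - r b - 1) = b\<close>.
\<close>

lemma diagram_of_hooks:
  assumes B: "B \<subseteq> {1..<n}"
  shows "diagram_of_hooks B \<in> hook_bounded_tableaux n"
    and "first_column_hooks (diagram_of_hooks B) = B"
proof -
  let ?D = "diagram_of_hooks B"
  have fin: "finite B" by (rule finite_subset[OF B]) simp
  define r where "r b = card {b'\<in>B. b' > b}" for b
  define s where "s b = card {b'\<in>B. b' < b}" for b
  have D: "(i, j) \<in> ?D \<longleftrightarrow> (\<exists>b\<in>B. i = r b \<and> j + s b < b)" for i j
    by (simp add: diagram_of_hooks_def r_def s_def)
  have total: "card B = r b + s b + 1" if "b \<in> B" for b
  proof -
    have "B = insert b ({b'\<in>B. b' > b} \<union> {b'\<in>B. b' < b})" using that by auto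
    also have "card \<dots> = Suc (card ({b'\<in>B. b' > b} \<union> {b'\<in>B. b' < b}))"
      using fin by (subst card_insert_disjoint) auto
    also have "card ({b'\<in>B. b' > b} \<union> {b'\<in>B. b' < b}) = r b + s b"
      unfolding r_def s_def using fin by (intro card_Un_disjoint) auto
    finally show ?thesis by simp
  qed
  have r_less: "r b' < r b" if "b < b'" "b' \<in> B" for b b'
    unfolding r_def using that fin by (intro psubset_card_mono) auto
  have r_less_iff: "r b' < r b \<longleftrightarrow> b < b'" if "b \<in> B" "b' \<in> B" for b b'
    using r_less that by (metis linorder_cases less_asym less_irrefl)
  have inj: "inj_on r B"
    using r_less_iff by (intro inj_onI) (metis linorder_cases less_irrefl)
  have "r ` B \<subseteq> {..<card B}" by (auto simp: total)
  then have image: "r ` B = {..<card B}"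
    using inj by (intro card_subset_eq) (auto simp: card_image)
  have s_less: "s b < b" if "b \<in> B" for b
  proof -
    have "s b \<le> card {1..<b}" unfolding s_def using B by (intro card_mono) auto
    then show ?thesis using subsetD[OF B that] by simp linarith
  qed
  have s_gap: "b - s b \<le> b' - s b'" if "b \<le> b'" for b b'
  proof -
    have "s b' \<le> card ({x\<in>B. x < b} \<union> {b..<b'})"
      unfolding s_def using fin by (intro card_mono) auto
    also have "\<dots> \<le> s b + (b' - b)"
      unfolding s_def using card_Un_le[of "{x\<in>B. x < b}" "{b..<b'}"] by simp
    finally show ?thesis using that by linarith
  qed
  have down: "(i', j') \<in> ?D" if ij: "(i, j) \<in> ?D" and le: "i' \<le> i" "j' \<le> j" for i j i' j'
  proof -
    obtain b where b: "b \<in> B" "i = r b" "j + s b < b" using D ij by blast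
    have "i' < card B" using le b total[of b] by simp
    then obtain b' where b': "b' \<in> B" "i' = r b'" using image by blast
    have "b \<le> b'" using r_less[of b' b] b b' le by (metis leD leI)
    then have "j' + s b' < b'" using s_gap[of b b'] b le by linarith
    then show ?thesis using D b' by blast
  qed
  have "?D \<subseteq> {..<card B} \<times> {..<n}"
  proof (rule subrelI)
    fix i j assume "(i, j) \<in> ?D"
    then obtain b where b: "b \<in> B" "i = r b" "j + s b < b" using D by blast
    then show "(i, j) \<in> {..<card B} \<times> {..<n}" using total[of b] subsetD[OF B b(1)] by simp
  qed
  then have "finite ?D" by (rule finite_subset) simp
  then have young: "young_diagram ?D" unfolding young_diagram_def by (intro conjI allI impI) (assumption, rule down)
  have row: "{j. (r b, j) \<in> ?D} = {..<b - s b}" if b: "b \<in> B" for b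
  proof -
    have "b' = b" if "b' \<in> B" "r b = r b'" for b' by (rule inj_onD[OF inj]) (use b that in simp_all)
    then have "{j. (r b, j) \<in> ?D} = {j. j + s b < b}" unfolding D using b by blast
    also have "\<dots> = {..<b - s b}" by auto
    finally show ?thesis .
  qed
  have col: "{i. (i, 0) \<in> ?D} = {..<card B}"
    by (auto simp: D s_less simp flip: image)
  have hook: "hook_length ?D (r b, 0) = b" if "b \<in> B" for b
  proof -
    have "(r b, 0) \<in> ?D" unfolding D using s_less[OF that] that by auto
    then have "hook_length ?D (r b, 0) = (b - s b) + card B - (r b + 0 + 1)"
      using hook_length_eq(1)[OF young] row[OF that] col by simp
    then show ?thesis using total[OF that] s_less[OF that] by simp
  qed
  show "first_column_hooks ?D = B"
  proof -
    have "first_column_hooks ?D = (\<lambda>b. hook_length ?D (r b, 0)) ` B"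
      unfolding first_column_hooks_def D by (auto simp: s_less)
    also have "\<dots> = (\<lambda>b. b) ` B" by (intro image_cong refl) (rule hook)
    finally show ?thesis by simp
  qed
  have "i + j + 1 < n" if i: "(i, 0) \<in> ?D" and j: "(0, j) \<in> ?D" for i j
  proof -
    obtain b where b: "b \<in> B" "0 = r b" "j + s b < b" using D j by blast
    have "i < card B" using i col by blast
    then show ?thesis using b total[of b] subsetD[OF B b(1)] by simp
  qed
  then show "?D \<in> hook_bounded_tableaux n"
    using young hook_bounded_iff[OF young] by (simp add: hook_bounded_tableaux_def)
qed

lemma bij_betw_first_column_hooks:
  "bij_betw first_column_hooks (hook_bounded_tableaux n) (Pow {1..<n})"
proof (rule bij_betw_byWitness[where f' = diagram_of_hooks])
  show "\<forall>D\<in>hook_bounded_tableaux n. diagram_of_hooks (first_column_hooks D) = D"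
    using diagram_of_first_column_hooks by (simp add: hook_bounded_tableaux_def)
qed (use first_column_hooks_subset diagram_of_hooks in blast)+

section \<open>Abelian ideals\<close>

definition mat_unit :: "nat \<Rightarrow> nat \<Rightarrow> nat \<Rightarrow> complex mat" where
  "mat_unit n i j = mat n n (\<lambda>p. if p = (i, j) then 1 else 0)"

text \<open>
  The columns are counted from the right because an ideal of upper triangular matrices grows from
  the top right corner, where a Young diagram has its cell \<open>(0, 0)\<close>.
\<close>

definition diagram_ideal :: "nat \<Rightarrow> (nat \<times> nat) set \<Rightarrow> complex mat set" where
  "diagram_ideal n D =
     {A \<in> carrier_mat n n. \<forall>i<n. \<forall>j<n. A $$ (i, j) \<noteq> 0 \<longrightarrow> (i, n - 1 - j) \<in> D}"

lemma mult_entry: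
  assumes "A \<in> carrier_mat n n" "B \<in> carrier_mat n n" "i < n" "j < n"
  shows "(A * B) $$ (i, j) = (\<Sum>k<n. A $$ (i, k) * B $$ (k, j))"
  using assms by (simp add: scalar_prod_def atLeast0LessThan)

lemma mat_unit_carrier [simp]: "mat_unit n i j \<in> carrier_mat n n"
  by (simp add: mat_unit_def)

lemma mat_unit_entry [simp]:
  "a < n \<Longrightarrow> b < n \<Longrightarrow> mat_unit n i j $$ (a, b) = (if a = i \<and> b = j then 1 else 0)"
  by (simp add: mat_unit_def)

lemma mat_unit_mult_entry:
  assumes A: "A \<in> carrier_mat n n" and "i < n" "j < n" "a < n" "b < n"
  shows "(mat_unit n i j * A) $$ (a, b) = (if a = i then A $$ (j, b) else 0)"
    and "(A * mat_unit n i j) $$ (a, b) = (if b = j then A $$ (a, i) else 0)"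
proof -
  have "(mat_unit n i j * A) $$ (a, b) = (\<Sum>k<n. mat_unit n i j $$ (a, k) * A $$ (k, b))"
    using assms by (intro mult_entry) auto
  also have "\<dots> = (\<Sum>k<n. if k = j then (if a = i then A $$ (j, b) else 0) else 0)"
    using assms by (intro sum.cong) auto
  finally show "(mat_unit n i j * A) $$ (a, b) = (if a = i then A $$ (j, b) else 0)"
    using assms by simp
  have "(A * mat_unit n i j) $$ (a, b) = (\<Sum>k<n. A $$ (a, k) * mat_unit n i j $$ (k, b))"
    using assms by (intro mult_entry) auto
  also have "\<dots> = (\<Sum>k<n. if k = i then (if b = j then A $$ (a, i) else 0) else 0)"
    using assms by (intro sum.cong) auto
  finally show "(A * mat_unit n i j) $$ (a, b) = (if b = j then A $$ (a, i) else 0)"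
    using assms by simp
qed

lemma lie_bracket_carrier:
  "A \<in> carrier_mat n n \<Longrightarrow> B \<in> carrier_mat n n \<Longrightarrow> lie_bracket A B \<in> carrier_mat n n"
  by (auto simp: lie_bracket_def)

lemma lie_bracket_entry:
  assumes "A \<in> carrier_mat n n" "B \<in> carrier_mat n n" "i < n" "j < n"
  shows "lie_bracket A B $$ (i, j) = (A * B) $$ (i, j) - (B * A) $$ (i, j)"
  using assms by (simp add: lie_bracket_def)

lemma strictly_upper_in_nilradical:
  assumes A: "A \<in> carrier_mat n n"
    and zero: "\<And>i j. i < n \<Longrightarrow> j < n \<Longrightarrow> j \<le> i \<Longrightarrow> A $$ (i, j) = 0"
  shows "A \<in> nilradical_sl n"
  using assms by (auto simp: nilradical_sl_def borel_sl_def sl_def mat_trace_def)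

lemma nilradical_entry_zero:
  assumes "A \<in> nilradical_sl n" "i < n" "j \<le> i"
  shows "A $$ (i, j) = 0"
  using assms by (cases "j = i") (auto simp: nilradical_sl_def borel_sl_def sl_def upper_triangular_def)

lemma mat_unit_in_borel:
  assumes "i < j" "j < n"
  shows "mat_unit n i j \<in> borel_sl n"
proof -
  have "mat_unit n i j \<in> nilradical_sl n"
    using assms by (intro strictly_upper_in_nilradical) auto
  then show ?thesis by (simp add: nilradical_sl_def)
qed

text \<open>
  The diagonal unit \<open>E\<^sub>i\<^sub>i\<close> is not traceless, but subtracting \<open>1 / n\<close> times the identity makes it so
  without changing any bracket.
\<close>

lemma diagonal_bracket_in_ideal:
  assumes I: "borel_ideal n I" and A: "A \<in> I" and i: "i < n"
  shows "lie_bracket (mat_unit n i i) A \<in> I"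
proof -
  define H where "H = mat n n (\<lambda>(a, b). if a = b then (if a = i then 1 else 0) - 1 / of_nat n else 0 :: complex)"
  have H: "H \<in> carrier_mat n n" by (simp add: H_def)
  have cA: "A \<in> carrier_mat n n" using I A by (auto simp: borel_ideal_def complex_subspace_def)
  have "mat_trace H = (\<Sum>a<n. (if a = i then 1 else 0) - 1 / of_nat n)"
    by (simp add: mat_trace_def H_def)
  also have "\<dots> = 0" using i by (simp add: sum_subtractf)
  finally have "H \<in> borel_sl n" using H by (auto simp: borel_sl_def sl_def H_def)
  then have "lie_bracket H A \<in> I" using I A by (simp add: borel_ideal_def)
  moreover have "lie_bracket H A = lie_bracket (mat_unit n i i) A"
  proof (rule eq_matI)
    fix a b assume "a < dim_row (lie_bracket (mat_unit n i i) A)" "b < dim_col (lie_bracket (mat_unit n i i) A)"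
    then have ab: "a < n" "b < n"
      using lie_bracket_carrier[OF mat_unit_carrier cA, of i i] by auto
    have "(H * A) $$ (a, b) = (\<Sum>k<n. if k = a then ((if a = i then 1 else 0) - 1 / of_nat n) * A $$ (a, b) else 0)"
      unfolding mult_entry[OF H cA ab] using ab by (intro sum.cong) (auto simp: H_def)
    then have HA: "(H * A) $$ (a, b) = ((if a = i then 1 else 0) - 1 / of_nat n) * A $$ (a, b)"
      using ab by simp
    have "(A * H) $$ (a, b) = (\<Sum>k<n. if k = b then ((if b = i then 1 else 0) - 1 / of_nat n) * A $$ (a, b) else 0)"
      unfolding mult_entry[OF cA H ab] using ab by (intro sum.cong) (auto simp: H_def)
    then have AH: "(A * H) $$ (a, b) = ((if b = i then 1 else 0) - 1 / of_nat n) * A $$ (a, b)"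
      using ab by simp
    show "lie_bracket H A $$ (a, b) = lie_bracket (mat_unit n i i) A $$ (a, b)"
      unfolding lie_bracket_entry[OF H cA ab] lie_bracket_entry[OF mat_unit_carrier cA ab]
        mat_unit_mult_entry[OF cA i i ab] HA AH
      by (auto simp: left_diff_distrib)
  qed (use lie_bracket_carrier[OF H cA] lie_bracket_carrier[OF mat_unit_carrier cA, of i i] in auto)
  ultimately show ?thesis by simp
qed

text \<open>
  Weight projection: \<open>[E\<^sub>i\<^sub>i, A]\<close> keeps row \<open>i\<close> of \<open>A\<close> and minus column \<open>i\<close>. Since \<open>A\<close> is strictly upper
  triangular and \<open>i < j\<close>, applying \<open>[E\<^sub>j\<^sub>j, _]\<close> leaves only \<open>- A\<^sub>i\<^sub>j E\<^sub>i\<^sub>j\<close>.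
\<close>

lemma mat_unit_in_ideal:
  assumes I: "borel_ideal n I" "I \<subseteq> nilradical_sl n" and A: "A \<in> I"
    and ij: "i < n" "j < n" and nz: "A $$ (i, j) \<noteq> 0"
  shows "mat_unit n i j \<in> I"
proof -
  have cA: "A \<in> carrier_mat n n" using I A by (auto simp: borel_ideal_def complex_subspace_def)
  have less: "i < j" using nilradical_entry_zero[of A n i j] I(2) A ij nz by (meson not_le subsetD)
  let ?Ei = "mat_unit n i i" and ?Ej = "mat_unit n j j"
  let ?B = "lie_bracket ?Ei A"
  have B: "?B \<in> I" by (rule diagonal_bracket_in_ideal[OF I(1) A ij(1)])
  have cB: "?B \<in> carrier_mat n n" by (rule lie_bracket_carrier[OF mat_unit_carrier cA])
  have C: "lie_bracket ?Ej ?B \<in> I" by (rule diagonal_bracket_in_ideal[OF I(1) B ij(2)])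
  have Bent: "?B $$ (a, b) = (if a = i then A $$ (i, b) else 0) - (if b = i then A $$ (a, i) else 0)"
    if "a < n" "b < n" for a b
    using that lie_bracket_entry[OF mat_unit_carrier cA that] mat_unit_mult_entry[OF cA ij(1) ij(1) that] by simp
  have Aji: "A $$ (j, i) = 0" using nilradical_entry_zero[of A n j i] I(2) A ij less by auto
  have "(- 1 / A $$ (i, j)) \<cdot>\<^sub>m lie_bracket ?Ej ?B \<in> I"
    using C I(1) by (simp add: borel_ideal_def complex_subspace_def)
  moreover have "(- 1 / A $$ (i, j)) \<cdot>\<^sub>m lie_bracket ?Ej ?B = mat_unit n i j"
  proof (rule eq_matI)
    fix a b assume "a < dim_row (mat_unit n i j)" "b < dim_col (mat_unit n i j)"
    then have ab: "a < n" "b < n" by (auto simp: mat_unit_def)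
    have "lie_bracket ?Ej ?B $$ (a, b) = (if a = j then ?B $$ (j, b) else 0) - (if b = j then ?B $$ (a, j) else 0)"
      using lie_bracket_entry[OF mat_unit_carrier cB ab] mat_unit_mult_entry[OF cB ij(2) ij(2) ab] by simp
    also have "\<dots> = (if a = i \<and> b = j then - A $$ (i, j) else 0)"
      using Bent ab ij less Aji by auto
    finally have "lie_bracket ?Ej ?B $$ (a, b) = (if a = i \<and> b = j then - A $$ (i, j) else 0)" .
    then show "((- 1 / A $$ (i, j)) \<cdot>\<^sub>m lie_bracket ?Ej ?B) $$ (a, b) = mat_unit n i j $$ (a, b)"
      using ab nz lie_bracket_carrier[OF mat_unit_carrier cB, of j j] by auto
  qed (use lie_bracket_carrier[OF mat_unit_carrier cB, of j j] in \<open>auto simp: mat_unit_def\<close>)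
  ultimately show ?thesis by simp
qed

lemma subspace_contains_of_mat_units:
  assumes I: "complex_subspace n I" and A: "A \<in> carrier_mat n n"
    and units: "\<And>i j. i < n \<Longrightarrow> j < n \<Longrightarrow> A $$ (i, j) \<noteq> 0 \<Longrightarrow> mat_unit n i j \<in> I"
  shows "A \<in> I"
proof -
  define part where "part P = mat n n (\<lambda>p. if p \<in> P then A $$ p else 0)" for P
  have "part P \<in> I" if "finite P" "P \<subseteq> {..<n} \<times> {..<n}" for P
    using that
  proof (induction P rule: finite_induct)
    case empty
    have "part {} = 0\<^sub>m n n" by (rule eq_matI) (auto simp: part_def)
    then show ?case using I by (simp add: complex_subspace_def)
  next
    case (insert p P)
    obtain i j where p: "p = (i, j)" by (cases p)
    have ij: "i < n" "j < n" using insert.prems p by auto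
    have IH: "part P \<in> I" using insert by simp
    show ?case
    proof (cases "A $$ (i, j) = 0")
      case True
      have "part (insert p P) = part P" using True p by (intro eq_matI) (auto simp: part_def)
      then show ?thesis using IH by simp
    next
      case False
      have "part (insert p P) = part P + A $$ (i, j) \<cdot>\<^sub>m mat_unit n i j"
        using insert.hyps(2) p by (intro eq_matI) (auto simp: part_def mat_unit_def)
      moreover have "A $$ (i, j) \<cdot>\<^sub>m mat_unit n i j \<in> I"
        using I units[OF ij False] by (simp add: complex_subspace_def)
      ultimately show ?thesis using IH I by (simp add: complex_subspace_def)
    qed
  qed
  then have "part ({..<n} \<times> {..<n}) \<in> I" by simp
  moreover have "part ({..<n} \<times> {..<n}) = A"
    using A by (intro eq_matI) (auto simp: part_def)
  ultimately show ?thesis by simp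
qed

lemma mat_unit_in_diagram_ideal_iff:
  assumes "i < n" "c < n"
  shows "mat_unit n i (n - 1 - c) \<in> diagram_ideal n D \<longleftrightarrow> (i, c) \<in> D"
  using assms by (auto simp: diagram_ideal_def)

text \<open>
  Multiplying by an upper triangular matrix moves entries up or to the right, that is, towards the
  corner of the diagram. A nonzero term \<open>A\<^sub>i\<^sub>k B\<^sub>k\<^sub>j\<close> would make \<open>k\<close> both an occurring column and an
  occurring row, so that the corner hook would be at least \<open>n\<close>; hence all products vanish. For the
  same reason only positions strictly above the diagonal occur.
\<close>

lemma diagram_ideal_abelian:
  assumes D: "D \<in> hook_bounded_tableaux n"
  shows "diagram_ideal n D \<in> abelian_nilradical_ideals n"
proof -
  have young: "young_diagram D" using D by (simp add: hook_bounded_tableaux_def)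
  have down: "(i', j') \<in> D" if "(i, j) \<in> D" "i' \<le> i" "j' \<le> j" for i j i' j'
    using young_diagram_down[OF young that] .
  have bound: "i + j + 1 < n" if "(i, 0) \<in> D" "(0, j) \<in> D" for i j
    using D hook_bounded_iff[OF young] that by (auto simp: hook_bounded_tableaux_def)
  let ?I = "diagram_ideal n D"
  have carrier: "A \<in> carrier_mat n n" if "A \<in> ?I" for A using that by (simp add: diagram_ideal_def)
  have supp: "(i, n - 1 - j) \<in> D" if "A \<in> ?I" "i < n" "j < n" "A $$ (i, j) \<noteq> 0" for A i j
    using that by (simp add: diagram_ideal_def)
  have nil: "?I \<subseteq> nilradical_sl n"
  proof
    fix A assume A: "A \<in> ?I"
    show "A \<in> nilradical_sl n"
    proof (rule strictly_upper_in_nilradical[OF carrier[OF A]])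
      fix i j assume ij: "i < n" "j < n" "j \<le> i"
      show "A $$ (i, j) = 0"
      proof (rule ccontr)
        assume "A $$ (i, j) \<noteq> 0"
        then have "(i, n - 1 - j) \<in> D" using supp[OF A] ij by blast
        then have "(i, 0) \<in> D" "(0, n - 1 - j) \<in> D" using down by blast+
        then show False using bound ij by fastforce
      qed
    qed
  qed
  have sub: "complex_subspace n ?I"
    unfolding complex_subspace_def
  proof (intro conjI ballI allI)
    show "A + B \<in> ?I" if "A \<in> ?I" "B \<in> ?I" for A B
    proof -
      have "A $$ (i, j) \<noteq> 0 \<or> B $$ (i, j) \<noteq> 0" if "i < n" "j < n" "(A + B) $$ (i, j) \<noteq> 0" for i j
        using carrier[OF \<open>A \<in> ?I\<close>] carrier[OF \<open>B \<in> ?I\<close>] that by auto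
      then have "(i, n - 1 - j) \<in> D" if "i < n" "j < n" "(A + B) $$ (i, j) \<noteq> 0" for i j
        using that supp[OF \<open>A \<in> ?I\<close>] supp[OF \<open>B \<in> ?I\<close>] by blast
      then show ?thesis
        using carrier[OF \<open>A \<in> ?I\<close>] carrier[OF \<open>B \<in> ?I\<close>] by (simp add: diagram_ideal_def)
    qed
  qed (auto simp: diagram_ideal_def)
  have ideal: "lie_bracket X A \<in> ?I" if X: "X \<in> borel_sl n" and A: "A \<in> ?I" for X A
  proof -
    have cX: "X \<in> carrier_mat n n" and upper: "\<And>i j. j < i \<Longrightarrow> i < n \<Longrightarrow> X $$ (i, j) = 0"
      using X by (auto simp: borel_sl_def sl_def upper_triangular_def)
    note cA = carrier[OF A]
    have "lie_bracket X A $$ (i, j) = 0" if ij: "i < n" "j < n" and out: "(i, n - 1 - j) \<notin> D" for i j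
    proof -
      have XA: "X $$ (i, k) * A $$ (k, j) = 0" if "k < n" for k
      proof (cases "k < i")
        case False
        have "A $$ (k, j) = 0"
          using supp[OF A \<open>k < n\<close> ij(2)] down[of k "n - 1 - j" i "n - 1 - j"] False out by fastforce
        then show ?thesis by simp
      qed (use upper ij in simp)
      have AX: "A $$ (i, k) * X $$ (k, j) = 0" if "k < n" for k
      proof (cases "j < k")
        case False
        have "A $$ (i, k) = 0"
          using supp[OF A ij(1) \<open>k < n\<close>] down[of i "n - 1 - k" i "n - 1 - j"] False out by fastforce
        then show ?thesis by simp
      qed (use upper that in simp)
      show ?thesis
        unfolding lie_bracket_entry[OF cX cA ij] mult_entry[OF cX cA ij] mult_entry[OF cA cX ij]
        by (simp add: XA AX del: mult_eq_0_iff)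
    qed
    then show ?thesis
      using lie_bracket_carrier[OF cX cA] unfolding diagram_ideal_def by blast
  qed
  have mult: "(A * B) $$ (i, j) = 0" if A: "A \<in> ?I" and B: "B \<in> ?I" and ij: "i < n" "j < n" for A B i j
  proof -
    have "A $$ (i, k) * B $$ (k, j) = 0" if k: "k < n" for k
    proof (rule ccontr)
      assume "A $$ (i, k) * B $$ (k, j) \<noteq> 0"
      then have "(i, n - 1 - k) \<in> D" "(k, n - 1 - j) \<in> D"
        using supp[OF A ij(1) k] supp[OF B k ij(2)] by auto
      then have "(0, n - 1 - k) \<in> D" "(k, 0) \<in> D" using down by blast+
      then show False using bound[of k "n - 1 - k"] k by simp
    qed
    then show ?thesis unfolding mult_entry[OF carrier[OF A] carrier[OF B] ij] by (intro sum.neutral) simp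
  qed
  have abel: "lie_bracket A B = 0\<^sub>m n n" if A: "A \<in> ?I" and B: "B \<in> ?I" for A B
  proof (rule eq_matI)
    fix i j assume "i < dim_row (0\<^sub>m n n :: complex mat)" "j < dim_col (0\<^sub>m n n :: complex mat)"
    then show "lie_bracket A B $$ (i, j) = 0\<^sub>m n n $$ (i, j)"
      using mult[OF A B] mult[OF B A] lie_bracket_entry[OF carrier[OF A] carrier[OF B]] by simp
  qed (use lie_bracket_carrier[OF carrier[OF A] carrier[OF B]] in auto)
  show ?thesis
    using sub nil ideal abel by (auto simp: abelian_nilradical_ideals_def borel_ideal_def nilradical_sl_def)
qed

text \<open>
  The diagram collects the positions of the matrix units in the ideal, and weight projection shows
  that the ideal is determined by them. If the corner hook were too long, the ideal would contain, for some
  \<open>k\<close>, both \<open>E\<^sub>0\<^sub>k\<close> and the unit of row \<open>k\<close> and the last column; their bracket is the unit in the top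
  right corner, which is not zero.
\<close>

lemma abelian_ideal_is_diagram_ideal:
  assumes n: "n \<ge> 1" and "I \<in> abelian_nilradical_ideals n"
  shows "\<exists>D\<in>hook_bounded_tableaux n. diagram_ideal n D = I"
proof -
  have I: "borel_ideal n I" "I \<subseteq> nilradical_sl n"
    and abel: "\<And>A B. A \<in> I \<Longrightarrow> B \<in> I \<Longrightarrow> lie_bracket A B = 0\<^sub>m n n"
    using assms(2) by (auto simp: abelian_nilradical_ideals_def)
  have sub: "complex_subspace n I" and ideal: "\<And>X A. X \<in> borel_sl n \<Longrightarrow> A \<in> I \<Longrightarrow> lie_bracket X A \<in> I"
    using I(1) by (auto simp: borel_ideal_def)
  have less: "i < j" if "mat_unit n i j \<in> I" "i < n" "j < n" for i j
    using nilradical_entry_zero[of "mat_unit n i j" n i j] I(2) that by (metis mat_unit_entry not_le subsetD zero_neq_one)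
  have bracket_entry: "lie_bracket (mat_unit n i j) (mat_unit n j k) $$ (i, k) = 1"
    if "i < j" "j < k" "k < n" for i j k
    using that lie_bracket_entry[OF mat_unit_carrier mat_unit_carrier, of i n k]
      mat_unit_mult_entry[OF mat_unit_carrier, of i n j i k] mat_unit_mult_entry[OF mat_unit_carrier, of j n k i k]
    by simp
  have up_row: "mat_unit n i' j \<in> I" if E: "mat_unit n i j \<in> I" and "i' \<le> i" "i < n" "j < n" for i i' j
  proof (cases "i' = i")
    case False
    then have l: "i' < i" "i < j" using that less by auto
    have "lie_bracket (mat_unit n i' i) (mat_unit n i j) \<in> I"
      by (rule ideal[OF mat_unit_in_borel E]) (use l that in auto)
    then show ?thesis
      using bracket_entry[OF l] that l by (intro mat_unit_in_ideal[OF I]) auto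
  qed (use E in simp)
  have up_col: "mat_unit n i j' \<in> I" if E: "mat_unit n i j \<in> I" and "j \<le> j'" "i < n" "j' < n" for i j j'
  proof (cases "j' = j")
    case False
    then have l: "i < j" "j < j'" using that less by auto
    let ?C = "lie_bracket (mat_unit n j j') (mat_unit n i j)"
    have "?C \<in> I"
      by (rule ideal[OF mat_unit_in_borel E]) (use l that in auto)
    moreover have "?C $$ (i, j') = - 1"
      using that l lie_bracket_entry[OF mat_unit_carrier mat_unit_carrier, of i n j']
        mat_unit_mult_entry[OF mat_unit_carrier, of j n j' i j'] by simp
    ultimately show ?thesis
      using that l by (intro mat_unit_in_ideal[OF I, of ?C]) auto
  qed (use E in simp)
  define D where "D = {(i, c). i < n \<and> c < n \<and> mat_unit n i (n - 1 - c) \<in> I}"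
  have young: "young_diagram D"
    unfolding young_diagram_def
  proof (intro conjI allI impI)
    show "finite D" by (rule finite_subset[of _ "{..<n} \<times> {..<n}"]) (auto simp: D_def)
    fix i c i' c' assume "(i, c) \<in> D" and le: "i' \<le> i" "c' \<le> c"
    then have *: "i < n" "c < n" "mat_unit n i (n - 1 - c) \<in> I" by (auto simp: D_def)
    have "mat_unit n i' (n - 1 - c) \<in> I" using up_row[OF *(3) le(1)] * by simp
    then have "mat_unit n i' (n - 1 - c') \<in> I"
      by (rule up_col[where j = "n - 1 - c"]) (use le * in auto)
    then show "(i', c') \<in> D" using le * by (simp add: D_def)
  qed
  have "i + c + 1 < n" if i: "(i, 0) \<in> D" and c: "(0, c) \<in> D" for i c
  proof (rule ccontr)
    assume "\<not> i + c + 1 < n"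
    \<comment> \<open>\<open>k\<close> is the matrix column of the cell \<open>(0, c)\<close>; a long corner hook means \<open>k \<le> i\<close>, so \<open>k\<close> is also an occurring row.\<close>
    define k where "k = n - 1 - c"
    have "(k, 0) \<in> D"
      by (rule young_diagram_down[OF young i]) (use \<open>\<not> i + c + 1 < n\<close> in \<open>auto simp: k_def\<close>)
    then have k: "mat_unit n k (n - 1) \<in> I" "k < n" and 0: "mat_unit n 0 k \<in> I"
      using c by (auto simp: D_def k_def)
    have l: "0 < k" "k < n - 1" "n - 1 < n" using less[OF 0] less[OF k(1)] k n by auto
    have "lie_bracket (mat_unit n 0 k) (mat_unit n k (n - 1)) $$ (0, n - 1) = 1"
      using l by (rule bracket_entry)
    then show False using abel[OF 0 k(1)] n by simp
  qed
  then have "D \<in> hook_bounded_tableaux n"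
    using young hook_bounded_iff[OF young] by (simp add: hook_bounded_tableaux_def)
  moreover have "diagram_ideal n D = I"
  proof (intro equalityI subsetI)
    fix A assume A: "A \<in> diagram_ideal n D"
    show "A \<in> I"
    proof (rule subspace_contains_of_mat_units[OF sub])
      show "mat_unit n i j \<in> I" if "i < n" "j < n" "A $$ (i, j) \<noteq> 0" for i j
      proof -
        have "(i, n - 1 - j) \<in> D" using A that by (simp add: diagram_ideal_def)
        then show ?thesis using that by (simp add: D_def)
      qed
    qed (use A in \<open>simp add: diagram_ideal_def\<close>)
  next
    fix A assume A: "A \<in> I"
    have "(i, n - 1 - j) \<in> D" if "i < n" "j < n" "A $$ (i, j) \<noteq> 0" for i j
      using mat_unit_in_ideal[OF I A that] that by (simp add: D_def)
    moreover have "A \<in> carrier_mat n n" using sub A by (auto simp: complex_subspace_def)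
    ultimately show "A \<in> diagram_ideal n D" by (simp add: diagram_ideal_def)
  qed
  ultimately show ?thesis by blast
qed

lemma bij_betw_diagram_ideal:
  assumes n: "n \<ge> 1"
  shows "bij_betw (diagram_ideal n) (hook_bounded_tableaux n) (abelian_nilradical_ideals n)"
proof (rule bij_betw_imageI)
  have box: "i < n \<and> c < n" if "D \<in> hook_bounded_tableaux n" "(i, c) \<in> D" for D i c
  proof -
    have young: "young_diagram D" using that by (simp add: hook_bounded_tableaux_def)
    have "(i, 0) \<in> D" "(0, c) \<in> D"
      using young_diagram_down[OF young that(2)] by blast+
    then have "i + c + 1 < n"
      using that hook_bounded_iff[OF young] by (auto simp: hook_bounded_tableaux_def)
    then show ?thesis by simp
  qed
  show "inj_on (diagram_ideal n) (hook_bounded_tableaux n)"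
  proof (rule inj_onI)
    fix D D' assume D: "D \<in> hook_bounded_tableaux n" and D': "D' \<in> hook_bounded_tableaux n"
      and eq: "diagram_ideal n D = diagram_ideal n D'"
    have "(i, c) \<in> D \<longleftrightarrow> (i, c) \<in> D'" for i c
      using mat_unit_in_diagram_ideal_iff[of i n c D] mat_unit_in_diagram_ideal_iff[of i n c D']
        box[OF D, of i c] box[OF D', of i c] eq by blast
    then show "D = D'" by auto
  qed
  show "diagram_ideal n ` hook_bounded_tableaux n = abelian_nilradical_ideals n"
    using diagram_ideal_abelian abelian_ideal_is_diagram_ideal[OF n] by blast
qed

theorem theorem6:
  fixes n :: nat
  assumes "n \<ge> 2"
  shows "(\<exists>f. bij_betw f (um_vectors n) (hook_bounded_tableaux n)) \<and>
         (\<exists>g. bij_betw g (um_vectors n) (abelian_nilradical_ideals n))"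
proof -
  have n: "n \<ge> 1" using assms by simp
  have tent: "bij_betw (tent_vec n) (even_subsets n) (um_vectors n)"
    using inj_on_tent_vec um_vectors_eq_tent_vecs[OF assms] by (simp add: bij_betw_def)
  obtain f where f: "bij_betw f (um_vectors n) (hook_bounded_tableaux n)"
    using bij_betw_trans[OF bij_betw_trans[OF bij_betw_inv_into[OF tent] bij_betw_even_subsets_Pow[OF n]]
        bij_betw_inv_into[OF bij_betw_first_column_hooks]] by blast
  then show ?thesis using bij_betw_trans[OF f bij_betw_diagram_ideal[OF n]] by blast
qed

end
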